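(* Let $(S,\mathcal B(S))$ be a standard Borel space and let $R$ be a Markov kernel on $(S,\mathcal B(S))$. Assume that there exists a nonzero $\sigma$-finite measure $\nu$ on $(S,\mathcal B(S))$ such that $$\nu\ll R(x,\cdot)\qquad\text{for all }x\in S.$$ Then every invariant probability measure $\mu$ of $R$ satisfies $\nu\ll\mu$.
   Context: A probability measure $\mu$ on $(S,\mathcal B(S))$ is invariant for $R$ if $\mu R=\mu$, i.e. $\int_S R(x,A)\,\mu(dx)=\mu(A)$ for all $A\in\mathcal B(S)$. For measures $\nu,\lambda$ on $(S,\mathcal B(S))$, $\nu\ll\lambda$ means that $\lambda(A)=0$ implies $\nu(A)=0$ for every $A\in\mathcal B(S)$. *)

theory Defs
  imports "HOL-Probability.Probability"
begin

(* Only the underlying measurable space of S matters: the measure carried by S is irrelevant. *)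
definition standard_borel_space :: "'a measure \<Rightarrow> bool" where
  "standard_borel_space S \<longleftrightarrow>
     (\<exists>X. completely_metrizable_space X \<and> second_countable X \<and>
          space S = topspace X \<and> sets S = sigma_sets (topspace X) {U. openin X U})"

abbreviation markov_kernel :: "'a measure \<Rightarrow> ('a \<Rightarrow> 'a measure) \<Rightarrow> bool" where
  "markov_kernel S R \<equiv> R \<in> S \<rightarrow>\<^sub>M prob_algebra S"

definition invariant_prob :: "'a measure \<Rightarrow> ('a \<Rightarrow> 'a measure) \<Rightarrow> 'a measure \<Rightarrow> bool" where
  "invariant_prob S R \<mu> \<longleftrightarrow>
     prob_space \<mu> \<and> sets \<mu> = sets S \<and>
     (\<forall>A\<in>sets S. (\<integral>\<^sup>+x. emeasure (R x) A \<partial>\<mu>) = emeasure \<mu> A)"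

end

theory Submission
  imports Defs
begin

text \<open>Under an invariant probability \<open>\<mu>\<close>, a \<open>\<mu>\<close>-null set is missed in one step from almost every
  starting point, because its mass is the \<open>\<mu>\<close>-average of the nonnegative numbers \<open>R x A\<close>. As \<open>\<mu>\<close>
  has mass 1, such a starting point \<open>x\<close> exists, and \<open>\<nu> \<lless> R x\<close> for this single \<open>x\<close>
  gives \<open>\<nu> A = 0\<close>.\<close>

lemma invariant_prob_null_set_imp_kernel_null_set:
  assumes R: "markov_kernel S R" and inv: "invariant_prob S R \<mu>" and A: "A \<in> null_sets \<mu>"
  shows "\<exists>x\<in>space S. A \<in> null_sets (R x)"
proof -
  interpret prob_space \<mu>
    using inv by (simp add: invariant_prob_def)
  have sets_\<mu>: "sets \<mu> = sets S"
    using inv by (simp add: invariant_prob_def)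
  have space_\<mu>: "space \<mu> = space S"
    by (rule sets_eq_imp_space_eq [OF sets_\<mu>])
  have AS: "A \<in> sets S"
    using A sets_\<mu> by auto
  have "R \<in> \<mu> \<rightarrow>\<^sub>M subprob_algebra S"
    using measurable_prob_algebraD [OF R] measurable_cong_sets [OF sets_\<mu> refl] by blast
  then have meas: "(\<lambda>x. emeasure (R x) A) \<in> borel_measurable \<mu>"
    by (rule measurable_emeasure_kernel [OF _ AS])
  have "(\<integral>\<^sup>+x. emeasure (R x) A \<partial>\<mu>) = emeasure \<mu> A"
    using inv AS by (simp add: invariant_prob_def)
  then have "(\<integral>\<^sup>+x. emeasure (R x) A \<partial>\<mu>) = 0"
    using A by auto
  then have "AE x in \<mu>. emeasure (R x) A = 0"
    using nn_integral_0_iff_AE [OF meas] by simp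
  \<comment> \<open>An almost sure property of a probability measure holds somewhere.\<close>
  then have "\<exists>x\<in>space \<mu>. emeasure (R x) A = 0"
    using AE_contr by blast
  then obtain x where x: "x \<in> space S" "emeasure (R x) A = 0"
    using space_\<mu> by auto
  have "sets (R x) = sets S"
    using measurable_space [OF R x(1)] by (simp add: space_prob_algebra)
  with x AS show ?thesis
    by (auto intro!: bexI [of _ x])
qed

(* The library's absolutely_continuous takes the dominating measure first:
   absolutely_continuous M N means N << M. *)
theorem proposition3p4:
  fixes S :: "'a measure" and R :: "'a \<Rightarrow> 'a measure" and \<nu> :: "'a measure"
  assumes "standard_borel_space S"
    and "markov_kernel S R"
    and "sets \<nu> = sets S" and "sigma_finite_measure \<nu>" and "emeasure \<nu> (space S) \<noteq> 0"
    and "\<And>x. x \<in> space S \<Longrightarrow> absolutely_continuous (R x) \<nu>"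
  shows "\<forall>\<mu>. invariant_prob S R \<mu> \<longrightarrow> absolutely_continuous \<mu> \<nu>"
  using invariant_prob_null_set_imp_kernel_null_set [OF assms(2)] assms(6)
  unfolding absolutely_continuous_def by blast

end
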